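(* Let $n\ge 2$, $1\le k\le \lfloor n/2\rfloor$ and $1\le r\le n-1$ be integers. Let $\beta_{r,k,n}$ be the rank of the rational Chow cohomology group $A^r(X_{k,n})$, equivalently the dimension of the $\mathbb{Q}$-vector space $\mathcal{M}_r$ of rational Minkowski weights on codimension-$r$ cones of the normal fan of $\Delta_{k,n}$ (defined in the context). Then \[ \beta_{r,k,n}=\begin{cases}\sum_{i=0}^{r-1}\binom{n}{i} & \text{if } 1\le r\le k,\\[2pt] \sum_{i=0}^{k-1}\binom{n}{i} & \text{if } k<r<n-k,\\[2pt] \sum_{i=0}^{n-r-1}\binom{n}{i} & \text{if } n-k\le r\le n-1.\end{cases} \] Moreover, a $\mathbb{Q}$-basis of $\mathcal{M}_r$ is given by the functions $c^{r,k,n}_S$, where $S$ runs over all subsets of $\{1,\dots,n\}$ of size at most $r-1$, $k-1$, and $n-r-1$ in the three cases respectively, and $c^{r,k,n}_S$ is defined on pairs $(I,J)$ in $\mathcal{P}_r$ by \[ c^{r,k,n}_S(I,J)=\begin{cases}1 & \text{if } S\subseteq I\cup J \text{ and } |J\cap S|=\ell^{r,k,n}(I,J),\\ 0 & \text{otherwise.}\end{cases} \]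
   Context: The hypersimplex $\Delta_{k,n}$ is the convex hull of all $0/1$-vectors in $\mathbb{R}^n$ with exactly $k$ ones; $X_{k,n}$ is the complex projective toric variety of its normal fan. The codimension-$r$ cones of the normal fan of $\Delta_{k,n}$ are indexed by the set $\mathcal{P}_r$ of ordered pairs $(I,J)$ of disjoint subsets of $\{1,\dots,n\}$ with $|I|+|J|=n-r-1$, $|I|<k$ and $|J|<n-k$. The level $\ell^{r,k,n}(I,J)$ of $(I,J)\in\mathcal{P}_r$ is $m-|I|$, where $m$ is the maximum of $|I'|$ over all $(I',J')\in\mathcal{P}_r$. By Fulton–Sturmfels, $A^r(X_{k,n})\otimes\mathbb{Q}$ is naturally isomorphic to the space $\mathcal{M}_r$ of Minkowski weights on codimension-$r$ cones, which here are the functions $c:\mathcal{P}_r\to\mathbb{Q}$ satisfying the balancing conditions: (i) $c(A\cup\{x\},B)-c(A\cup\{y\},B)=c(A,B\cup\{x\})-c(A,B\cup\{y\})$ whenever these four pairs lie in $\mathcal{P}_r$ (with $A,B,\{x\},\{y\}$ pairwise disjoint), $|A|<k-1$ and $|B|<n-k-1$; (ii) $c(I,J)=c(I,J')$ whenever $(I,J),(I,J')\in\mathcal{P}_r$ and $|I|=k-1$; (iii) $c(I,J)=c(I',J)$ whenever $(I,J),(I',J)\in\mathcal{P}_r$ and $|J|=n-k-1$. *)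

theory Defs
  imports Complex_Main "HOL-Library.Function_Algebras"
begin

definition rat_scale :: "rat \<Rightarrow> ('a \<Rightarrow> rat) \<Rightarrow> 'a \<Rightarrow> rat" where
  "rat_scale q f = (\<lambda>x. q * f x)"

interpretation ratfun: vector_space "rat_scale :: rat \<Rightarrow> ('a \<Rightarrow> rat) \<Rightarrow> 'a \<Rightarrow> rat"
  by unfold_locales (auto simp: rat_scale_def fun_eq_iff algebra_simps)

text \<open>
  The pairs indexing the codimension-\<open>r\<close> cones of the normal fan of the hypersimplex
  \<open>\<Delta>\<^sub>k\<^sub>,\<^sub>n\<close>. For \<open>1 \<le> k < n\<close> and \<open>1 \<le> r \<le> n - 1\<close>
  no natural number subtraction below truncates on these pairs, and the level of a pair depends on
  its first component only.
\<close>

definition cone_pairs :: "nat \<Rightarrow> nat \<Rightarrow> nat \<Rightarrow> (nat set \<times> nat set) set" where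
  "cone_pairs r k n =
     {(I, J). I \<subseteq> {1..n} \<and> J \<subseteq> {1..n} \<and> I \<inter> J = {} \<and>
              card I + card J = n - r - 1 \<and> card I < k \<and> card J < n - k}"

definition level :: "nat \<Rightarrow> nat \<Rightarrow> nat \<Rightarrow> nat set \<Rightarrow> nat" where
  "level r k n I = Max ((\<lambda>(I', J'). card I') ` cone_pairs r k n) - card I"

text \<open>
  A function on \<open>cone_pairs r k n\<close> is represented by its extension by \<open>0\<close> to all pairs of sets,
  so the first clause does not constrain its values on \<open>cone_pairs r k n\<close>.
\<close>

definition minkowski_weights ::
    "nat \<Rightarrow> nat \<Rightarrow> nat \<Rightarrow> (nat set \<times> nat set \<Rightarrow> rat) set" where
  "minkowski_weights r k n =
     {c. (\<forall>p. p \<notin> cone_pairs r k n \<longrightarrow> c p = 0) \<and>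
         (\<forall>A B x y.
            x \<notin> A \<and> x \<notin> B \<and> y \<notin> A \<and> y \<notin> B \<and> x \<noteq> y \<and> A \<inter> B = {} \<and>
            (insert x A, B) \<in> cone_pairs r k n \<and> (insert y A, B) \<in> cone_pairs r k n \<and>
            (A, insert x B) \<in> cone_pairs r k n \<and> (A, insert y B) \<in> cone_pairs r k n \<and>
            card A < k - 1 \<and> card B < n - k - 1 \<longrightarrow>
            c (insert x A, B) - c (insert y A, B) = c (A, insert x B) - c (A, insert y B)) \<and>
         (\<forall>I J J'.
            (I, J) \<in> cone_pairs r k n \<and> (I, J') \<in> cone_pairs r k n \<and> card I = k - 1 \<longrightarrow>
            c (I, J) = c (I, J')) \<and>
         (\<forall>I I' J.
            (I, J) \<in> cone_pairs r k n \<and> (I', J) \<in> cone_pairs r k n \<and> card J = n - k - 1 \<longrightarrow>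
            c (I, J) = c (I', J))}"

lemma minkowski_weights_outside:
  assumes "c \<in> minkowski_weights r k n" and "p \<notin> cone_pairs r k n"
  shows "c p = 0"
proof -
  have "\<forall>p. p \<notin> cone_pairs r k n \<longrightarrow> c p = 0"
    using assms(1) unfolding minkowski_weights_def mem_Collect_eq by (elim conjE)
  from this[rule_format, OF assms(2)] show ?thesis .
qed

lemma minkowski_weights_exchange:
  assumes "c \<in> minkowski_weights r k n"
    and "x \<notin> A \<and> x \<notin> B \<and> y \<notin> A \<and> y \<notin> B \<and> x \<noteq> y \<and> A \<inter> B = {} \<and>
      (insert x A, B) \<in> cone_pairs r k n \<and> (insert y A, B) \<in> cone_pairs r k n \<and>
      (A, insert x B) \<in> cone_pairs r k n \<and> (A, insert y B) \<in> cone_pairs r k n \<and>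
      card A < k - 1 \<and> card B < n - k - 1"
  shows "c (insert x A, B) - c (insert y A, B) = c (A, insert x B) - c (A, insert y B)"
proof -
  have "\<forall>A B x y.
      x \<notin> A \<and> x \<notin> B \<and> y \<notin> A \<and> y \<notin> B \<and> x \<noteq> y \<and> A \<inter> B = {} \<and>
      (insert x A, B) \<in> cone_pairs r k n \<and> (insert y A, B) \<in> cone_pairs r k n \<and>
      (A, insert x B) \<in> cone_pairs r k n \<and> (A, insert y B) \<in> cone_pairs r k n \<and>
      card A < k - 1 \<and> card B < n - k - 1 \<longrightarrow>
      c (insert x A, B) - c (insert y A, B) = c (A, insert x B) - c (A, insert y B)"
    using assms(1) unfolding minkowski_weights_def mem_Collect_eq by (elim conjE)
  from this[rule_format, OF assms(2)] show ?thesis .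
qed

lemma minkowski_weights_left:
  assumes "c \<in> minkowski_weights r k n"
    and "(I, J) \<in> cone_pairs r k n \<and> (I, J') \<in> cone_pairs r k n \<and> card I = k - 1"
  shows "c (I, J) = c (I, J')"
proof -
  have "\<forall>I J J'.
      (I, J) \<in> cone_pairs r k n \<and> (I, J') \<in> cone_pairs r k n \<and> card I = k - 1 \<longrightarrow>
      c (I, J) = c (I, J')"
    using assms(1) unfolding minkowski_weights_def mem_Collect_eq by (elim conjE)
  from this[rule_format, OF assms(2)] show ?thesis .
qed

lemma minkowski_weights_right:
  assumes "c \<in> minkowski_weights r k n"
    and "(I, J) \<in> cone_pairs r k n \<and> (I', J) \<in> cone_pairs r k n \<and> card J = n - k - 1"
  shows "c (I, J) = c (I', J)"
proof -
  have "\<forall>I I' J.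
      (I, J) \<in> cone_pairs r k n \<and> (I', J) \<in> cone_pairs r k n \<and> card J = n - k - 1 \<longrightarrow>
      c (I, J) = c (I', J)"
    using assms(1) unfolding minkowski_weights_def mem_Collect_eq by (elim conjE)
  from this[rule_format, OF assms(2)] show ?thesis .
qed

lemma subspace_minkowski_weights: "ratfun.subspace (minkowski_weights r k n)"
proof (rule ratfun.subspaceI)
  show "0 \<in> minkowski_weights r k n"
    by (simp add: minkowski_weights_def)
next
  fix c d assume c: "c \<in> minkowski_weights r k n" and d: "d \<in> minkowski_weights r k n"
  show "c + d \<in> minkowski_weights r k n"
    unfolding minkowski_weights_def
  proof (intro CollectI conjI allI impI, goal_cases)
    case (1 p)
    from minkowski_weights_outside[OF c 1] minkowski_weights_outside[OF d 1] show ?case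
      by simp
  next
    case (2 A B x y)
    from minkowski_weights_exchange[OF c 2] minkowski_weights_exchange[OF d 2] show ?case
      unfolding plus_fun_def by linarith
  next
    case (3 I J J')
    from minkowski_weights_left[OF c 3] minkowski_weights_left[OF d 3] show ?case
      by simp
  next
    case (4 I I' J)
    from minkowski_weights_right[OF c 4] minkowski_weights_right[OF d 4] show ?case
      by simp
  qed
next
  fix q c assume c: "c \<in> minkowski_weights r k n"
  show "rat_scale q c \<in> minkowski_weights r k n"
    unfolding minkowski_weights_def
  proof (intro CollectI conjI allI impI, goal_cases)
    case (1 p)
    from minkowski_weights_outside[OF c 1] show ?case
      by (simp add: rat_scale_def)
  next
    case (2 A B x y)
    from minkowski_weights_exchange[OF c 2] show ?case
      by (simp add: rat_scale_def flip: right_diff_distrib)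
  next
    case (3 I J J')
    from minkowski_weights_left[OF c 3] show ?case
      by (simp add: rat_scale_def)
  next
    case (4 I I' J)
    from minkowski_weights_right[OF c 4] show ?case
      by (simp add: rat_scale_def)
  qed
qed

text \<open>
  The rank of \<open>A\<^sup>r(X\<^sub>k\<^sub>,\<^sub>n) \<otimes> \<rat>\<close>, through the Fulton-Sturmfels identification of this
  space with the Minkowski weights on codimension-\<open>r\<close> cones.
\<close>

definition chow_betti :: "nat \<Rightarrow> nat \<Rightarrow> nat \<Rightarrow> nat" where
  "chow_betti r k n = ratfun.dim (minkowski_weights r k n)"

definition basis_weight :: "nat \<Rightarrow> nat \<Rightarrow> nat \<Rightarrow> nat set \<Rightarrow> nat set \<times> nat set \<Rightarrow> rat" where
  "basis_weight r k n S =
     (\<lambda>(I, J). if (I, J) \<in> cone_pairs r k n \<and> S \<subseteq> I \<union> J \<and> card (J \<inter> S) = level r k n I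
               then 1 else 0)"

definition subsets_upto :: "nat \<Rightarrow> nat \<Rightarrow> nat set set" where
  "subsets_upto n d = {S. S \<subseteq> {1..n} \<and> card S \<le> d}"

definition is_family_basis ::
    "('i \<Rightarrow> 'a \<Rightarrow> rat) \<Rightarrow> 'i set \<Rightarrow> ('a \<Rightarrow> rat) set \<Rightarrow> bool" where
  "is_family_basis f A V \<longleftrightarrow>
     inj_on f A \<and> ratfun.independent (f ` A) \<and> ratfun.span (f ` A) = V"

end

theory Submission
  imports Defs
begin

text \<open>
  Let \<open>N = n - r - 1\<close>, let \<open>j0\<close> be the least and \<open>j0 + L\<close> the largest possible size
  of \<open>J\<close> in a pair \<open>(I, J)\<close>. A combination of the \<open>c\<^sub>S\<close> whose largest index sets have size
  \<open>s\<close> restricts on level \<open>s\<close> to \<open>J \<mapsto> (\<Sum>S\<subseteq>J, card S = s. a S)\<close>. Since the inclusion matrix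
  of \<open>s\<close>-sets in \<open>p\<close>-sets is injective for \<open>s \<le> p \<le> n - s\<close>, the \<open>c\<^sub>S\<close> are
  independent. Conversely, a weight that vanishes above level \<open>l\<close> is on level \<open>l\<close> a function
  \<open>h\<close> of \<open>J\<close>. The balancing condition trades a swap difference in \<open>J\<close> on one level for
  a swap difference in \<open>I\<close> on the level below, and on level \<open>0\<close> nothing depends on \<open>J\<close>; so
  \<open>h\<close> is annihilated by \<open>l + 1\<close> disjoint swap differences, which forces
  \<open>h J = (\<Sum>S\<subseteq>J, card S = l. a S)\<close>. Subtracting the corresponding combination of the
  \<open>c\<^sub>S\<close> lowers \<open>l\<close>.
\<close>

subsection \<open>Sums over the subsets of given size\<close>

text \<open>Toggling membership of a fixed point pairs subsets of opposite sign. Both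
  inclusion-exclusion arguments below rest on this cancellation.\<close>

lemma sum_Pow_alternating:
  assumes "finite X"
  shows "(\<Sum>Y\<in>Pow X. (- 1) ^ card Y) = (if X = {} then 1 else 0 :: rat)"
proof (cases "X = {}")
  case False
  then obtain x where x: "x \<in> X"
    by blast
  let ?Z = "Pow (X - {x})"
  have fin: "finite ?Z"
    using assms by simp
  have X: "Pow X = ?Z \<union> insert x ` ?Z"
    using Pow_insert[of x "X - {x}"] x by (simp add: insert_absorb)
  have inj: "inj_on (insert x) ?Z"
    by (auto simp: inj_on_def)
  have card: "card (insert x Y) = Suc (card Y)" if "Y \<in> ?Z" for Y
    using that assms by (subst card_insert_disjoint) (auto intro: finite_subset)
  have "(\<Sum>Y\<in>Pow X. (- 1) ^ card Y) =
      (\<Sum>Y\<in>?Z. (- 1) ^ card Y) + (\<Sum>Y\<in>insert x ` ?Z. (- 1) ^ card Y :: rat)"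
    unfolding X using fin by (intro sum.union_disjoint) auto
  also have "(\<Sum>Y\<in>insert x ` ?Z. (- 1) ^ card Y :: rat) = (\<Sum>Y\<in>?Z. - ((- 1) ^ card Y))"
    unfolding sum.reindex[OF inj] by (intro sum.cong) (simp_all add: card)
  finally show ?thesis
    using False by (simp add: sum_negf)
qed simp

text \<open>As \<open>J\<close> runs over the \<open>p\<close>-sets, this is the inclusion matrix of
  \<open>s\<close>-sets in \<open>p\<close>-sets applied to the vector \<open>a\<close>.\<close>

definition subset_sum :: "nat \<Rightarrow> ('a set \<Rightarrow> rat) \<Rightarrow> 'a set \<Rightarrow> rat" where
  "subset_sum s a J = (\<Sum>S | S \<subseteq> J \<and> card S = s. a S)"

lemma subset_sum_0: "finite J \<Longrightarrow> subset_sum 0 a J = a {}"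
proof -
  assume "finite J"
  then have "{S. S \<subseteq> J \<and> card S = 0} = {{}}"
    by (auto dest: finite_subset)
  then show ?thesis
    by (simp add: subset_sum_def)
qed

lemma subset_sum_insert:
  assumes "finite B" "x \<notin> B"
  shows "subset_sum (Suc s) a (insert x B) =
    subset_sum (Suc s) a B + subset_sum s (\<lambda>S. a (insert x S)) B"
proof -
  let ?T = "{S. S \<subseteq> B \<and> card S = s}"
  have fin: "finite S" if "S \<subseteq> insert x B" for S
    using that assms by (meson finite_insert finite_subset)
  have "{S. S \<subseteq> insert x B \<and> card S = Suc s} \<subseteq>
      {S. S \<subseteq> B \<and> card S = Suc s} \<union> insert x ` ?T"
  proof
    fix S assume S: "S \<in> {S. S \<subseteq> insert x B \<and> card S = Suc s}"
    show "S \<in> {S. S \<subseteq> B \<and> card S = Suc s} \<union> insert x ` ?T"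
    proof (cases "x \<in> S")
      case True
      then have "S = insert x (S - {x})" "S - {x} \<in> ?T"
        using S fin[of S] by auto
      then show ?thesis
        by blast
    qed (use S in auto)
  qed
  moreover have "card (insert x S) = Suc s" if "S \<in> ?T" for S
    using that assms fin[of S] by (subst card_insert_disjoint) auto
  ultimately have eq: "{S. S \<subseteq> insert x B \<and> card S = Suc s} =
      {S. S \<subseteq> B \<and> card S = Suc s} \<union> insert x ` ?T"
    by auto
  have inj: "inj_on (insert x) ?T"
    using assms by (auto simp: inj_on_def)
  have "subset_sum (Suc s) a (insert x B) =
      subset_sum (Suc s) a B + sum a (insert x ` ?T)"
    unfolding subset_sum_def eq using assms by (intro sum.union_disjoint) auto
  then show ?thesis
    by (simp add: subset_sum_def sum.reindex[OF inj])
qed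

lemma subset_sum_cong:
  assumes "\<And>S. S \<subseteq> J \<Longrightarrow> card S = s \<Longrightarrow> a S = b S"
  shows "subset_sum s a J = subset_sum s b J"
  unfolding subset_sum_def using assms by (intro sum.cong) auto

lemma subset_sum_diff:
  "subset_sum s (\<lambda>S. a S - b S) J = subset_sum s a J - subset_sum s b J"
  by (simp add: subset_sum_def sum_subtractf)

text \<open>Double counting: an \<open>s\<close>-subset of \<open>K\<close> survives the deletion of
  exactly \<open>card K - s\<close> points.\<close>

lemma subset_sum_add_one:
  assumes "finite K"
  shows "(\<Sum>x\<in>K. subset_sum s a (K - {x})) = of_nat (card K - s) * subset_sum s a K"
proof -
  have "(\<Sum>x\<in>K. subset_sum s a (K - {x})) =
      (\<Sum>x\<in>K. \<Sum>S | S \<in> Pow K \<and> (card S = s \<and> x \<notin> S). a S)"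
    unfolding subset_sum_def by (intro sum.cong refl) auto
  also have "\<dots> = (\<Sum>S\<in>Pow K. \<Sum>x | x \<in> K \<and> (card S = s \<and> x \<notin> S). a S)"
    using assms by (intro sum.swap_restrict) auto
  also have "\<dots> = (\<Sum>S\<in>Pow K. if card S = s then of_nat (card K - s) * a S else 0)"
  proof (intro sum.cong refl)
    fix S assume "S \<in> Pow K"
    moreover have "{x. x \<in> K \<and> x \<notin> S} = K - S"
      by auto
    ultimately show "(\<Sum>x | x \<in> K \<and> (card S = s \<and> x \<notin> S). a S) =
        (if card S = s then of_nat (card K - s) * a S else 0)"
      using assms by (auto simp: card_Diff_subset finite_subset)
  qed
  also have "\<dots> = (\<Sum>S | S \<in> Pow K \<and> card S = s. of_nat (card K - s) * a S)"
    using assms by (intro sum.inter_filter[symmetric]) auto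
  also have "\<dots> = of_nat (card K - s) * subset_sum s a K"
    by (simp add: subset_sum_def sum_distrib_left)
  finally show ?thesis .
qed

text \<open>Each \<open>s\<close>-subset of \<open>J\<close> arises as \<open>T - {x}\<close> from
  exactly \<open>card J - s\<close> pairs \<open>(T, x)\<close>. The new coefficients depend on
  \<open>J\<close> only through \<open>card J\<close>, so one choice serves all sets of a given
  size.\<close>

lemma subset_sum_raise_one:
  assumes "finite J" "s < card J"
  shows "subset_sum s a J =
    subset_sum (Suc s) (\<lambda>T. (\<Sum>x\<in>T. a (T - {x})) / of_nat (card J - s)) J"
proof -
  have fin: "finite S" if "S \<subseteq> J" for S
    using that assms finite_subset by blast
  let ?A = "{T. T \<subseteq> J \<and> card T = Suc s}" and ?B = "{S. S \<subseteq> J \<and> card S = s}"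
  have "(\<Sum>T\<in>?A. \<Sum>x\<in>T. a (T - {x})) = (\<Sum>(T, x)\<in>Sigma ?A (\<lambda>T. T). a (T - {x}))"
    using assms fin by (intro sum.Sigma) auto
  also have "\<dots> = (\<Sum>(S, x)\<in>Sigma ?B (\<lambda>S. J - S). a S)"
    by (rule sum.reindex_bij_witness[where i = "\<lambda>(S, x). (insert x S, x)" and
          j = "\<lambda>(T, x). (T - {x}, x)"])
      (auto simp: insert_absorb fin)
  also have "\<dots> = (\<Sum>S\<in>?B. \<Sum>x\<in>J - S. a S)"
    using assms fin by (intro sum.Sigma[symmetric]) auto
  also have "\<dots> = (\<Sum>S\<in>?B. of_nat (card J - s) * a S)"
    using fin by (intro sum.cong) (auto simp: card_Diff_subset)
  finally have "(\<Sum>T\<in>?A. \<Sum>x\<in>T. a (T - {x})) = of_nat (card J - s) * subset_sum s a J"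
    by (simp add: subset_sum_def sum_distrib_left)
  then show ?thesis
    using assms by (simp add: subset_sum_def flip: sum_divide_distrib)
qed

lemma subset_sum_raise:
  assumes "s \<le> l" "l \<le> p"
  obtains b where "\<And>J. finite J \<Longrightarrow> card J = p \<Longrightarrow> subset_sum s a J = subset_sum l b J"
proof -
  have "\<exists>b. \<forall>J. finite J \<and> card J = p \<longrightarrow> subset_sum s a J = subset_sum l b J"
    using assms
  proof (induction l rule: dec_induct)
    case (step l)
    then obtain b where b: "\<forall>J. finite J \<and> card J = p \<longrightarrow> subset_sum s a J = subset_sum l b J"
      by auto
    have "subset_sum s a J =
        subset_sum (Suc l) (\<lambda>T. (\<Sum>x\<in>T. b (T - {x})) / of_nat (p - l)) J"
      if "finite J" "card J = p" for J
      using that b step.prems subset_sum_raise_one[of J l b] by auto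
    then show ?case
      by blast
  qed auto
  then show ?thesis
    using that by blast
qed

text \<open>Injectivity of the inclusion matrix. Averaging over one-point deletions carries the
  vanishing to all larger sets; inclusion-exclusion over \<open>Y \<subseteq> S\<close> then
  isolates \<open>a S\<close>.\<close>

lemma subset_sum_eq_0_imp:
  assumes "finite V" "s \<le> p" "p + s \<le> card V"
    and zero: "\<And>J. J \<subseteq> V \<Longrightarrow> card J = p \<Longrightarrow> subset_sum s a J = 0"
    and S: "S \<subseteq> V" "card S = s"
  shows "a S = 0"
proof -
  have fin: "finite K" if "K \<subseteq> V" for K
    using that assms(1) finite_subset by blast
  have large: "subset_sum s a K = 0" if "p \<le> q" "K \<subseteq> V" "card K = q" for q K
    using that
  proof (induction q arbitrary: K rule: dec_induct)
    case (step q)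
    then have "subset_sum s a (K - {x}) = 0" if "x \<in> K" for x
      by (intro step.IH) (use step.prems that in auto)
    then have "of_nat (card K - s) * subset_sum s a K = 0"
      using subset_sum_add_one[OF fin[OF step.prems(1)], of s a] by simp
    then show ?case
      using step assms(2) by auto
  qed (use zero in auto)
  let ?T = "{T. T \<subseteq> V \<and> card T = s}"
  \<comment> \<open>The bound \<open>p + s \<le> card V\<close> keeps every \<open>V - Y\<close> at
    size \<open>p\<close> or more. Summing the signs over the \<open>Y\<close> disjoint from
    \<open>T\<close> leaves only \<open>T = S\<close>.\<close>
  have "0 = (\<Sum>Y\<in>Pow S. (- 1) ^ card Y * subset_sum s a (V - Y))"
  proof (rule sum.neutral[symmetric], rule ballI)
    fix Y assume "Y \<in> Pow S"
    then have "Y \<subseteq> V" "card Y \<le> s"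
      using S card_mono[OF fin[OF S(1)]] by auto
    then have "p \<le> card (V - Y)"
      using assms(3) by (simp add: card_Diff_subset fin)
    then show "(- 1) ^ card Y * subset_sum s a (V - Y) = 0"
      using large by auto
  qed
  also have "\<dots> = (\<Sum>Y\<in>Pow S. \<Sum>T | T \<in> ?T \<and> T \<inter> Y = {}. (- 1) ^ card Y * a T)"
    unfolding subset_sum_def sum_distrib_left by (intro sum.cong refl) auto
  also have "\<dots> = (\<Sum>T\<in>?T. \<Sum>Y | Y \<in> Pow S \<and> T \<inter> Y = {}. (- 1) ^ card Y * a T)"
    using fin[OF S(1)] assms(1) by (intro sum.swap_restrict) auto
  also have "\<dots> = (\<Sum>T\<in>?T. if T = S then a T else 0)"
  proof (intro sum.cong refl)
    fix T assume T: "T \<in> ?T"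
    have "{Y. Y \<in> Pow S \<and> T \<inter> Y = {}} = Pow (S - T)"
      by auto
    moreover have "S - T = {} \<longleftrightarrow> T = S"
      using T S fin card_subset_eq[of T S] by auto
    ultimately show "(\<Sum>Y | Y \<in> Pow S \<and> T \<inter> Y = {}. (- 1) ^ card Y * a T) =
        (if T = S then a T else 0)"
      using sum_Pow_alternating[of "S - T"] fin[OF S(1)] by (simp flip: sum_distrib_right)
  qed
  also have "\<dots> = a S"
    using S assms(1) by simp
  finally show ?thesis
    by simp
qed

text \<open>
  For \<open>p\<close>-sets \<open>J\<close> and \<open>K\<close>, the alternating sum over \<open>S \<subseteq> J - K\<close> is the indicator of
  \<open>J = K\<close>. As \<open>V - K\<close> has only \<open>l\<close> points, this expands \<open>h\<close> over sets \<open>S\<close> of size at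
  most \<open>l\<close>, and smaller sizes are raised to \<open>l\<close>.
\<close>

lemma subset_sum_surj_complementary:
  assumes "finite V" "l \<le> p" "card V = p + l"
  obtains a where "\<And>J. J \<subseteq> V \<Longrightarrow> card J = p \<Longrightarrow> h J = subset_sum l a J"
proof -
  let ?P = "{K. K \<subseteq> V \<and> card K = p}"
  define a where "a S = (- 1) ^ card S * (\<Sum>K | K \<in> ?P \<and> S \<inter> K = {}. h K)" for S
  have fin: "finite K" if "K \<subseteq> V" for K
    using that assms(1) finite_subset by blast
  have expand: "h J = (\<Sum>s\<le>l. subset_sum s a J)" if J: "J \<subseteq> V" "card J = p" for J
  proof -
    have "h J = (\<Sum>K\<in>?P. if K = J then h K else 0)"
      using J assms(1) by simp
    also have "\<dots> = (\<Sum>K\<in>?P. \<Sum>S | S \<in> Pow J \<and> S \<inter> K = {}. (- 1) ^ card S * h K)"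
    proof (intro sum.cong refl)
      fix K assume K: "K \<in> ?P"
      have "{S. S \<in> Pow J \<and> S \<inter> K = {}} = Pow (J - K)"
        by auto
      moreover have "J - K = {} \<longleftrightarrow> K = J"
        using K J fin card_subset_eq[of K J] by auto
      ultimately show "(if K = J then h K else 0) =
          (\<Sum>S | S \<in> Pow J \<and> S \<inter> K = {}. (- 1) ^ card S * h K)"
        using sum_Pow_alternating[of "J - K"] fin[OF J(1)] by (simp flip: sum_distrib_right)
    qed
    also have "\<dots> = (\<Sum>S\<in>Pow J. \<Sum>K | K \<in> ?P \<and> S \<inter> K = {}. (- 1) ^ card S * h K)"
      using fin[OF J(1)] assms(1) by (intro sum.swap_restrict) auto
    also have "\<dots> = sum a (Pow J)"
      by (simp add: a_def sum_distrib_left)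
    also have "\<dots> = sum a {S \<in> Pow J. card S \<le> l}"
    proof (rule sum.mono_neutral_right)
      show "\<forall>S\<in>Pow J - {S \<in> Pow J. card S \<le> l}. a S = 0"
      proof
        fix S assume S: "S \<in> Pow J - {S \<in> Pow J. card S \<le> l}"
        have False if "K \<in> ?P" "S \<inter> K = {}" for K
        proof -
          have "card (S \<union> K) \<le> card V"
            using S J that assms(1) by (intro card_mono) auto
          then show False
            using that S J fin assms(3) by (subst (asm) card_Un_disjoint) auto
        qed
        then have "{K. K \<in> ?P \<and> S \<inter> K = {}} = {}"
          by blast
        then show "a S = 0"
          unfolding a_def by (simp only: sum.empty mult_zero_right)
      qed
    qed (use fin J in auto)
    also have "\<dots> = (\<Sum>s\<le>l. \<Sum>S | S \<in> {S \<in> Pow J. card S \<le> l} \<and> card S = s. a S)"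
      using fin[OF J(1)] by (intro sum.group[symmetric]) auto
    also have "\<dots> = (\<Sum>s\<le>l. subset_sum s a J)"
      unfolding subset_sum_def by (intro sum.cong) auto
    finally show ?thesis .
  qed
  have "\<forall>s. \<exists>b. s \<le> l \<longrightarrow>
      (\<forall>J. finite J \<and> card J = p \<longrightarrow> subset_sum s a J = subset_sum l b J)"
    using subset_sum_raise[OF _ assms(2)] by metis
  then obtain b where b: "\<And>s J. s \<le> l \<Longrightarrow> finite J \<Longrightarrow> card J = p \<Longrightarrow>
      subset_sum s a J = subset_sum l (b s) J"
    by metis
  have "h J = subset_sum l (\<lambda>S. \<Sum>s\<le>l. b s S) J" if J: "J \<subseteq> V" "card J = p" for J
  proof -
    have "h J = (\<Sum>s\<le>l. subset_sum l (b s) J)"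
      using expand[OF J] b[OF _ fin[OF J(1)] J(2)] by simp
    then show ?thesis
      unfolding subset_sum_def by (subst sum.swap)
  qed
  then show ?thesis
    using that by blast
qed

subsection \<open>Iterated swap differences\<close>

text \<open>
  Only the values of \<open>h\<close> on the \<open>p\<close>-subsets of \<open>V\<close> matter. The condition is vacuous for
  \<open>p < d\<close>, when there are not enough points for \<open>d\<close> disjoint swaps.
\<close>

fun swap_vanishing :: "nat \<Rightarrow> 'a set \<Rightarrow> nat \<Rightarrow> ('a set \<Rightarrow> rat) \<Rightarrow> bool" where
  "swap_vanishing 0 V p h \<longleftrightarrow> (\<forall>J. J \<subseteq> V \<and> card J = p \<longrightarrow> h J = 0)"
| "swap_vanishing (Suc d) V 0 h \<longleftrightarrow> True"
| "swap_vanishing (Suc d) V (Suc p) h \<longleftrightarrow>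
     (\<forall>x\<in>V. \<forall>y\<in>V. x \<noteq> y \<longrightarrow>
        swap_vanishing d (V - {x, y}) p (\<lambda>B. h (insert x B) - h (insert y B)))"

lemma swap_vanishing_cong:
  assumes "finite V" and "\<And>J. J \<subseteq> V \<Longrightarrow> card J = p \<Longrightarrow> g J = h J"
  shows "swap_vanishing d V p g \<longleftrightarrow> swap_vanishing d V p h"
  using assms
proof (induction d V p g arbitrary: h rule: swap_vanishing.induct)
  case (3 d V p g)
  have "g (insert x B) - g (insert y B) = h (insert x B) - h (insert y B)"
    if "x \<in> V" "y \<in> V" "x \<noteq> y" "B \<subseteq> V - {x, y}" "card B = p" for x y B
  proof -
    have "finite B" "x \<notin> B" "y \<notin> B"
      using that 3(2) finite_subset by blast+
    then have "g (insert z B) = h (insert z B)" if "z \<in> {x, y}" for z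
      by (intro 3(3)) (use that \<open>x \<in> V\<close> \<open>y \<in> V\<close> \<open>B \<subseteq> V - {x, y}\<close> \<open>card B = p\<close> in auto)
    then show ?thesis
      by simp
  qed
  then show ?case
    using 3(1,2) by simp
qed auto

lemma swap_vanishing_mono:
  assumes "swap_vanishing d V p h" "U \<subseteq> V"
  shows "swap_vanishing d U p h"
  using assms
proof (induction d V p h arbitrary: U rule: swap_vanishing.induct)
  case (3 d V p h)
  have "swap_vanishing d (U - {x, y}) p (\<lambda>B. h (insert x B) - h (insert y B))"
    if xy: "x \<in> U" "y \<in> U" "x \<noteq> y" for x y
    by (rule 3(1)[of x y]) (use 3(2,3) xy in auto)
  then show ?case
    by simp
qed auto

lemma swap_vanishing_diff:
  assumes "swap_vanishing d V p g" "swap_vanishing d V p h"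
  shows "swap_vanishing d V p (\<lambda>J. g J - h J)"
  using assms
proof (induction d V p g arbitrary: h rule: swap_vanishing.induct)
  case (3 d V p g)
  have "swap_vanishing d (V - {x, y}) p
      (\<lambda>B. g (insert x B) - h (insert x B) - (g (insert y B) - h (insert y B)))"
    if "x \<in> V" "y \<in> V" "x \<noteq> y" for x y
  proof -
    have "swap_vanishing d (V - {x, y}) p
        (\<lambda>B. g (insert x B) - g (insert y B) - (h (insert x B) - h (insert y B)))"
      using 3 that by simp
    then show ?thesis
      by (simp add: algebra_simps)
  qed
  then show ?case
    by simp
qed auto

text \<open>\<open>subset_sum l a\<close> behaves like a polynomial of degree \<open>l\<close>: in a
  swap difference the sets avoiding both points cancel, which lowers the degree by one.\<close>

lemma swap_vanishing_subset_sum: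
  assumes "finite V"
  shows "swap_vanishing (Suc l) V p (subset_sum l a)"
  using assms
proof (induction l arbitrary: V p a)
  case 0
  show ?case
  proof (cases p)
    case (Suc q)
    have "swap_vanishing 0 (V - {x, y}) q
        (\<lambda>B. subset_sum 0 a (insert x B) - subset_sum 0 a (insert y B))" for x y
      using 0 by (auto simp: subset_sum_0 finite_subset)
    then show ?thesis
      using Suc by simp
  qed simp
next
  case (Suc l)
  show ?case
  proof (cases p)
    case (Suc q)
    have "swap_vanishing (Suc l) (V - {x, y}) q
        (\<lambda>B. subset_sum (Suc l) a (insert x B) - subset_sum (Suc l) a (insert y B))"
      if "x \<in> V" "y \<in> V" "x \<noteq> y" for x y
    proof -
      have "subset_sum (Suc l) a (insert x B) - subset_sum (Suc l) a (insert y B) =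
          subset_sum l (\<lambda>S. a (insert x S) - a (insert y S)) B"
        if "B \<subseteq> V - {x, y}" for B
      proof -
        have "finite B" "x \<notin> B" "y \<notin> B"
          using that Suc.prems finite_subset by blast+
        then show ?thesis
          by (simp add: subset_sum_insert subset_sum_diff)
      qed
      then show ?thesis
        using Suc.IH[of "V - {x, y}" q "\<lambda>S. a (insert x S) - a (insert y S)"] Suc.prems
        by (subst swap_vanishing_cong) auto
    qed
    then show ?thesis
      using Suc by simp
  qed simp
qed

text \<open>An instance of the condition involves \<open>d\<close> pairs of swapped points and
  \<open>p - d\<close> further ones, \<open>p + d\<close> in all, so it fits inside some
  \<open>q\<close>-subset of \<open>V\<close>.\<close>

lemma swap_vanishing_local:
  assumes "finite V" "p + d \<le> q" "q \<le> card V"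
    and "\<And>U. U \<subseteq> V \<Longrightarrow> card U = q \<Longrightarrow> swap_vanishing d U p h"
  shows "swap_vanishing d V p h"
  using assms
proof (induction d V p h arbitrary: q rule: swap_vanishing.induct)
  case (1 V p h)
  have "h J = 0" if J: "J \<subseteq> V" "card J = p" for J
  proof -
    obtain U where "J \<subseteq> U" "U \<subseteq> V" "card U = q"
      using exists_subset_between[of J q V] 1 J by auto
    then show ?thesis
      using 1(4) J by auto
  qed
  then show ?case
    by simp
next
  case (3 d V p h)
  have "swap_vanishing d (V - {x, y}) p (\<lambda>B. h (insert x B) - h (insert y B))"
    if xy: "x \<in> V" "y \<in> V" "x \<noteq> y" for x y
  proof (rule 3(1)[OF xy, of "q - 2"])
    show "q - 2 \<le> card (V - {x, y})"
      using 3 xy by (simp add: card_Diff_subset)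
    fix U assume U: "U \<subseteq> V - {x, y}" "card U = q - 2"
    then have "finite U" "x \<notin> U" "y \<notin> U"
      using 3(2) finite_subset by blast+
    \<comment> \<open>Putting the two swapped points back turns \<open>U\<close> into a
      \<open>q\<close>-set, to which the hypothesis applies.\<close>
    then have "card (insert x (insert y U)) = q" and [simp]: "insert x (insert y U) - {x, y} = U"
      using U xy 3(3) by auto
    then have "swap_vanishing (Suc d) (insert x (insert y U)) (Suc p) h"
      by (intro 3(5)) (use U xy in auto)
    then show "swap_vanishing d U p (\<lambda>B. h (insert x B) - h (insert y B))"
      using xy by auto
  qed (use 3 in auto)
  then show ?case
    by simp
qed simp

text \<open>On \<open>U = V - {w}\<close> the swap of \<open>v\<close> and \<open>w\<close> is
  available, and its term with \<open>w\<close> is zero. The strict bound on \<open>p + d\<close>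
  makes these \<open>U\<close> large enough for \<open>swap_vanishing_local\<close>.\<close>

lemma swap_vanishing_peel:
  assumes V: "finite V" "v \<notin> V" "p + d < card V"
    and h: "swap_vanishing (Suc d) (insert v V) (Suc p) h"
    and zero: "\<And>J. J \<subseteq> V \<Longrightarrow> card J = Suc p \<Longrightarrow> h J = 0"
  shows "swap_vanishing d V p (\<lambda>B. h (insert v B))"
proof (rule swap_vanishing_local[OF V(1), of _ _ "card V - 1"])
  fix U assume U: "U \<subseteq> V" "card U = card V - 1"
  have finU: "finite U"
    using U V finite_subset by blast
  then have "card (V - U) = 1"
    using U V by (simp add: card_Diff_subset)
  then obtain w where w: "V - U = {w}"
    by (rule card_1_singletonE)
  then have eq: "insert v V - {v, w} = U"
    using V U by blast
  have "swap_vanishing d U p (\<lambda>B. h (insert v B) - h (insert w B))"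
    using h w V eq by (auto dest!: bspec[of _ _ v] bspec[of _ _ w])
  moreover have "h (insert w B) = 0" if "B \<subseteq> U" "card B = p" for B
  proof (rule zero)
    have "finite B" "w \<notin> B"
      using that finU w finite_subset by blast+
    then show "card (insert w B) = Suc p"
      using that by simp
  qed (use that U w in blast)
  ultimately show "swap_vanishing d U p (\<lambda>B. h (insert v B))"
    using swap_vanishing_cong[OF finU, of p "\<lambda>B. h (insert v B) - h (insert w B)"] by simp
qed (use V in auto)

text \<open>
  Induction on \<open>V\<close>: correct \<open>h\<close> so that it vanishes on the sets avoiding \<open>v\<close>. On the sets
  containing \<open>v\<close>, swapping \<open>v\<close> for a free point then uses up one swap difference, and the
  induction hypothesis applies with \<open>p\<close> and \<open>l\<close> both lowered by one.
\<close>

lemma swap_vanishing_imp_subset_sum: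
  assumes "finite V" "l \<le> p" "p + l \<le> card V" "swap_vanishing (Suc l) V p h"
  obtains a where "\<And>J. J \<subseteq> V \<Longrightarrow> card J = p \<Longrightarrow> h J = subset_sum l a J"
proof -
  have "\<exists>a. \<forall>J. J \<subseteq> V \<and> card J = p \<longrightarrow> h J = subset_sum l a J"
    using assms
  proof (induction V arbitrary: p l h rule: finite_induct)
    case empty
    then show ?case
      by (auto simp: subset_sum_0)
  next
    case (insert v V)
    have finV: "finite J" if "J \<subseteq> insert v V" for J
      using that insert.hyps finite_subset by (metis finite_insert)
    \<comment> \<open>In case \<open>base\<close>, deleting \<open>v\<close> would violate the size
      bound, so the complementary expansion ends the induction there.\<close>
    consider (base) "p + l = Suc (card V)" | (zero) "p = 0"
      | (step) q where "p = Suc q" "p + l \<le> card V"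
      using insert by (cases p) fastforce+
    then show ?case
    proof cases
      case base
      then obtain a where "\<And>J. J \<subseteq> insert v V \<Longrightarrow> card J = p \<Longrightarrow> h J = subset_sum l a J"
        using subset_sum_surj_complementary[of "insert v V" l p h] insert by auto
      then show ?thesis
        by blast
    next
      case zero
      have "h J = subset_sum l (\<lambda>_. h {}) J" if "J \<subseteq> insert v V" "card J = p" for J
        using zero that finV[of J] insert.prems by (auto simp: subset_sum_0)
      then show ?thesis
        by blast
    next
      case step
      have "swap_vanishing (Suc l) V p h"
        using insert.prems(3) by (rule swap_vanishing_mono) blast
      then obtain a0 where a0: "\<And>J. J \<subseteq> V \<Longrightarrow> card J = p \<Longrightarrow> h J = subset_sum l a0 J"
        using insert.IH[of l p h] insert.prems step by auto
      \<comment> \<open>Zero on the sets containing \<open>v\<close>, so that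
        \<open>subset_sum l a (insert v B)\<close> reduces to
        \<open>subset_sum l a B\<close>.\<close>
      define a where "a S = (if v \<in> S then 0 else a0 S)" for S
      have a: "h J = subset_sum l a J" if "J \<subseteq> V" "card J = p" for J
        unfolding a0[OF that] using that insert.hyps
        by (intro subset_sum_cong) (auto simp: a_def)
      have peel: "swap_vanishing l V q (\<lambda>B. h (insert v B) - subset_sum l a (insert v B))"
      proof (rule swap_vanishing_peel)
        show "swap_vanishing (Suc l) (insert v V) (Suc q) (\<lambda>J. h J - subset_sum l a J)"
          using insert step by (intro swap_vanishing_diff swap_vanishing_subset_sum) auto
      qed (use insert step a in auto)
      show ?thesis
      proof (cases l)
        case 0
        have "h J = subset_sum l a J" if J: "J \<subseteq> insert v V" "card J = p" for J
        proof (cases "v \<in> J")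
          case True
          then have "J - {v} \<subseteq> V" "card (J - {v}) = q"
            using J step finV[of J] by auto
          then show ?thesis
            using peel[unfolded 0 swap_vanishing.simps, rule_format, of "J - {v}"] True
            by (simp add: 0 insert_absorb)
        next
          case False
          then show ?thesis
            using J by (intro a) auto
        qed
        then show ?thesis
          by blast
      next
        case (Suc k)
        obtain b where b: "\<And>B. B \<subseteq> V \<Longrightarrow> card B = q \<Longrightarrow>
            h (insert v B) - subset_sum l a (insert v B) = subset_sum k b B"
          using insert.IH[of k q "\<lambda>B. h (insert v B) - subset_sum l a (insert v B)"]
            peel insert.prems step Suc by auto
        \<comment> \<open>The coefficients of the sets containing \<open>v\<close> are filled in
          from the corrected function, which has one degree less.\<close>
        define a' where "a' S = (if v \<in> S then b (S - {v}) else a0 S)" for S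
        have "h J = subset_sum l a' J" if J: "J \<subseteq> insert v V" "card J = p" for J
        proof (cases "v \<in> J")
          case True
          define B where "B = J - {v}"
          have B: "B \<subseteq> V" "card B = q" "finite B" "v \<notin> B" "J = insert v B"
            using J True step finV[of J] by (auto simp: B_def)
          have v: "v \<notin> S" if "S \<subseteq> B" for S
            using that B(4) by blast
          have "subset_sum l a' B = subset_sum l a B"
              "subset_sum k (\<lambda>S. a' (insert v S)) B = subset_sum k b B"
            using v by (auto intro!: subset_sum_cong simp: a_def a'_def)
          moreover have "subset_sum k (\<lambda>S. a (insert v S)) B = 0"
            by (simp add: a_def subset_sum_def)
          ultimately show ?thesis
            using b[OF B(1,2)] unfolding B(5) Suc
            by (simp add: subset_sum_insert[OF B(3,4)])
        next
          case False
          then have "J \<subseteq> V"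
            using J by blast
          then have "h J = subset_sum l a J"
            using J a by blast
          also have "\<dots> = subset_sum l a' J"
            using False by (intro subset_sum_cong) (auto simp: a_def a'_def)
          finally show ?thesis .
        qed
        then show ?thesis
          by blast
      qed
    qed
  qed
  then show ?thesis
    using that by blast
qed

subsection \<open>Minkowski weights of the hypersimplex\<close>

lemma exists_disjoint_subset:
  assumes "finite V" "J \<subseteq> V" "i + card J \<le> card V"
  obtains I where "I \<subseteq> V" "I \<inter> J = {}" "card I = i"
proof -
  have "i \<le> card (V - J)"
    using assms by (simp add: card_Diff_subset finite_subset)
  then obtain I where "I \<subseteq> V - J" "card I = i"
    by (rule obtain_subset_with_card_n)
  then show ?thesis
    using that by blast
qed

text \<open>The relation \<open>exchange\<close> trades a swap in the second component for one in
  the first. The differences in the first component again form such a family, on two points fewer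
  and with one level less, until \<open>bottom\<close> applies.\<close>

lemma swap_vanishing_of_exchange:
  assumes "finite U"
    and exchange: "\<And>A B x y. A \<subseteq> U \<Longrightarrow> B \<subseteq> U \<Longrightarrow> A \<inter> B = {} \<Longrightarrow>
      x \<in> U - A - B \<Longrightarrow> y \<in> U - A - B \<Longrightarrow> x \<noteq> y \<Longrightarrow>
      Suc (card A + card B) = N \<Longrightarrow> j \<le> card B \<Longrightarrow> card B < j + l \<Longrightarrow>
      c (insert x A, B) - c (insert y A, B) = c (A, insert x B) - c (A, insert y B)"
    and bottom: "\<And>A B B'. A \<subseteq> U \<Longrightarrow> B \<subseteq> U - A \<Longrightarrow> B' \<subseteq> U - A \<Longrightarrow>
      card A + j = N \<Longrightarrow> card B = j \<Longrightarrow> card B' = j \<Longrightarrow> c (A, B) = c (A, B')"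
    and A: "A \<subseteq> U" "card A + (j + l) = N"
  shows "swap_vanishing (Suc l) (U - A) (j + l) (\<lambda>B. c (A, B) :: rat)"
  using assms
proof (induction l arbitrary: U N c)
  case 0
  have fin: "finite B" if "B \<subseteq> U" for B
    using that 0(1) finite_subset by blast
  show ?case
  proof (cases j)
    case (Suc q)
    have "c (A, insert x B) = c (A, insert y B)"
      if xy: "x \<in> U - A" "y \<in> U - A" and B: "B \<subseteq> U - A - {x, y}" "card B = q" for x y B
    proof (rule 0(3))
      have "finite B" "x \<notin> B" "y \<notin> B"
        using B fin[of B] by auto
      then show "card (insert x B) = j" "card (insert y B) = j"
        using B Suc by auto
    qed (use xy B 0 in auto)
    then show ?thesis
      using Suc by simp
  qed simp
next
  case (Suc l)
  have fin: "finite B" if "B \<subseteq> U" for B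
    using that Suc.prems(1) finite_subset by blast
  have "swap_vanishing (Suc l) (U - A - {x, y}) (j + l)
      (\<lambda>B. c (A, insert x B) - c (A, insert y B))"
    if xy: "x \<in> U - A" "y \<in> U - A" "x \<noteq> y" for x y
  proof -
    \<comment> \<open>The inserted \<open>x\<close> or \<open>y\<close> takes up one element of the
      first component, whence \<open>N - 1\<close> below.\<close>
    let ?c = "\<lambda>(I, J). c (insert x I, J) - c (insert y I, J)" and ?U = "U - {x, y}"
    have "swap_vanishing (Suc l) (?U - A) (j + l) (\<lambda>B. ?c (A, B))"
    proof (rule Suc.IH[of ?U "N - 1"])
      fix A' B x' y'
      assume *: "A' \<subseteq> ?U" "B \<subseteq> ?U" "A' \<inter> B = {}" "x' \<in> ?U - A' - B" "y' \<in> ?U - A' - B"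
        "x' \<noteq> y'" "Suc (card A' + card B) = N - 1" "j \<le> card B" "card B < j + l"
      have "c (insert x' (insert z A'), B) - c (insert y' (insert z A'), B) =
          c (insert z A', insert x' B) - c (insert z A', insert y' B)" if "z \<in> {x, y}" for z
      proof (rule Suc.prems(2))
        have "finite A'" "z \<notin> A'"
          using * that fin[of A'] by auto
        then show "Suc (card (insert z A') + card B) = N"
          using * by simp
      qed (use * xy that in auto)
      from this[of x] this[of y]
      show "?c (insert x' A', B) - ?c (insert y' A', B) =
          ?c (A', insert x' B) - ?c (A', insert y' B)"
        by (simp add: insert_commute)
    next
      fix A' B B'
      assume *: "A' \<subseteq> ?U" "B \<subseteq> ?U - A'" "B' \<subseteq> ?U - A'" "card A' + j = N - 1"
        "card B = j" "card B' = j"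
      have "c (insert z A', B) = c (insert z A', B')" if "z \<in> {x, y}" for z
      proof (rule Suc.prems(3))
        have "finite A'" "z \<notin> A'"
          using * that fin[of A'] by auto
        then show "card (insert z A') + j = N"
          using * Suc.prems(5) by simp
      qed (use * xy that in auto)
      then show "?c (A', B) = ?c (A', B')"
        by simp
    qed (use Suc.prems xy in auto)
    moreover have "?c (A, B) = c (A, insert x B) - c (A, insert y B)"
      if "B \<subseteq> ?U - A" "card B = j + l" for B
      unfolding prod.case using that xy Suc.prems(4,5)
      by (intro Suc.prems(2)) auto
    moreover have "?U - A = U - A - {x, y}"
      by blast
    ultimately show ?thesis
      using swap_vanishing_cong[of "?U - A" "j + l" "\<lambda>B. ?c (A, B)"] Suc.prems(1) by auto
  qed
  then show ?case
    by simp
qed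

section \<open>Sizes and levels of cone pairs\<close>

locale hypersimplex =
  fixes n k r :: nat
  assumes k: "1 \<le> k" "k \<le> n div 2" and r: "1 \<le> r" "r \<le> n - 1"
begin

abbreviation "P \<equiv> cone_pairs r k n"
abbreviation "M \<equiv> minkowski_weights r k n"

definition "V = {1..n}"

lemma finite_V [simp]: "finite V" and card_V [simp]: "card V = n"
  by (simp_all add: V_def)

text \<open>
  On \<open>P\<close> the level of \<open>(I, J)\<close> is \<open>card J - j0\<close>; it ranges over \<open>0..L\<close>. In the
  three cases of the theorem \<open>L\<close> is \<open>r - 1\<close>, \<open>k - 1\<close> and \<open>n - r - 1\<close>.
\<close>

definition "N = n - r - 1"
definition "m = min (k - 1) N"
definition "j0 = N - m"
definition "L = m - (k - r)"

lemma two_k: "2 * k \<le> n" and n_pos: "2 \<le> n"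
  using k by linarith+

lemma m_le_N: "m \<le> N"
  by (simp add: m_def)

lemma j0_eq: "j0 = N - (k - 1)"
  by (simp add: j0_def m_def min_def)

text \<open>The truncated \<open>k - r\<close> is the least possible size of \<open>I\<close>,
  namely \<open>N - (n - k - 1)\<close>. Hence \<open>L\<close> is the difference between the
  largest and the least size of \<open>I\<close>.\<close>

lemma j0_L_eq: "j0 + L = min N (n - k - 1)"
proof -
  have "k - r \<le> k - 1" "k - r \<le> N"
    using two_k n_pos k r unfolding N_def by linarith+
  then have "k - r \<le> m"
    by (simp add: m_def)
  then have "j0 + L = N - (k - r)"
    using m_le_N unfolding j0_def L_def by linarith
  also have "\<dots> = min N (n - k - 1)"
  proof (cases "k \<le> r")
    case True
    then have "N \<le> n - k - 1"
      unfolding N_def by linarith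
    then show ?thesis
      using True by simp
  next
    case False
    then have "N - (k - r) = n - k - 1"
      using two_k n_pos unfolding N_def by linarith
    then show ?thesis
      by (metis diff_le_self min.absorb2)
  qed
  finally show ?thesis .
qed

lemma j0_L: "j0 + L \<le> N"
  by (simp add: j0_L_eq)

text \<open>With \<open>j0_L\<close> this gives \<open>j0 + s + s < n\<close> for
  \<open>s \<le> L\<close>, the room required by the inclusion matrix and by the swaps.\<close>

lemma N_L: "N + L < n"
proof -
  have "L \<le> r - 1"
    using k r unfolding L_def m_def by linarith
  then show ?thesis
    using r unfolding N_def by linarith
qed

lemma mem_cone_pairs:
  "(I, J) \<in> P \<longleftrightarrow> I \<subseteq> V \<and> J \<subseteq> V \<and> I \<inter> J = {} \<and> card I + card J = N \<and>
     j0 \<le> card J \<and> card J \<le> j0 + L"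
proof -
  have "card I < k \<and> card J < n - k \<longleftrightarrow> j0 \<le> card J \<and> card J \<le> j0 + L"
    if "card I + card J = N"
  proof -
    have "card I < k \<longleftrightarrow> j0 \<le> card J"
      using that k unfolding j0_eq by linarith
    moreover have "card J < n - k \<longleftrightarrow> card J \<le> j0 + L"
      using that two_k n_pos unfolding j0_L_eq by auto
    ultimately show ?thesis
      by simp
  qed
  then show ?thesis
    unfolding cone_pairs_def by (auto simp: N_def V_def)
qed

lemma finite_subset_V: "X \<subseteq> V \<Longrightarrow> finite X"
  using finite_V finite_subset by blast

lemma level_eq:
  assumes "(I, J) \<in> P"
  shows "level r k n I = card J - j0"
proof -
  have le: "card I' \<le> m" if "(I', J') \<in> P" for I' J'
    using that unfolding mem_cone_pairs j0_def by linarith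
  \<comment> \<open>The maximum \<open>m\<close> is attained at a second component of least size, as
    \<open>m + j0 = N\<close>.\<close>
  obtain J0 where J0: "J0 \<subseteq> V" "card J0 = j0"
    using j0_L N_L obtain_subset_with_card_n[of j0 V] by auto
  moreover obtain I0 where "I0 \<subseteq> V" "I0 \<inter> J0 = {}" "card I0 = m"
    using exists_disjoint_subset[of V J0 m] J0 N_L by (auto simp: j0_def m_def)
  ultimately have "(I0, J0) \<in> P" "card I0 = m"
    by (auto simp: mem_cone_pairs j0_def m_def)
  then have "m \<in> (\<lambda>(I', J'). card I') ` P"
    by force
  moreover have "P \<subseteq> Pow V \<times> Pow V"
    by (auto simp: mem_cone_pairs)
  then have "finite P"
    by (rule finite_subset) simp
  ultimately have "Max ((\<lambda>(I', J'). card I') ` P) = m"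
    using le by (intro Max_eqI) auto
  then show ?thesis
    using assms unfolding level_def mem_cone_pairs j0_def m_def by linarith
qed

lemma basis_weight_eq:
  assumes "(I, J) \<in> P"
  shows "basis_weight r k n S (I, J) =
    (if S \<subseteq> I \<union> J \<and> card (J \<inter> S) + j0 = card J then 1 else 0)"
proof -
  have "j0 \<le> card J"
    using assms by (simp add: mem_cone_pairs)
  then have "card (J \<inter> S) = card J - j0 \<longleftrightarrow> card (J \<inter> S) + j0 = card J"
    by linarith
  then show ?thesis
    using assms by (simp add: basis_weight_def level_eq)
qed

definition indices :: "nat set set" where
  "indices = subsets_upto n L"

lemma mem_indices: "S \<in> indices \<longleftrightarrow> S \<subseteq> V \<and> card S \<le> L"
  by (simp add: indices_def subsets_upto_def V_def)

lemma finite_indices: "finite indices"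
  by (simp add: indices_def subsets_upto_def)

section \<open>Balancing conditions sorted by level\<close>

lemma weights_exchange:
  assumes c: "c \<in> M"
    and AB: "A \<subseteq> V" "B \<subseteq> V" "A \<inter> B = {}" "x \<in> V - A - B" "y \<in> V - A - B" "x \<noteq> y"
    and card: "Suc (card A + card B) = N" "j0 \<le> card B" "card B < j0 + L"
  shows "c (insert x A, B) - c (insert y A, B) = c (A, insert x B) - c (A, insert y B)"
proof (rule minkowski_weights_exchange[OF c])
  have in_P: "(insert x A, B) \<in> P" "(insert y A, B) \<in> P"
      "(A, insert x B) \<in> P" "(A, insert y B) \<in> P"
    using AB card by (auto simp: mem_cone_pairs finite_subset_V)
  moreover have "card A < k - 1" "card B < n - k - 1"
    using in_P(1,3) AB unfolding cone_pairs_def by (auto simp: finite_subset_V)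
  ultimately show "x \<notin> A \<and> x \<notin> B \<and> y \<notin> A \<and> y \<notin> B \<and> x \<noteq> y \<and> A \<inter> B = {} \<and>
      (insert x A, B) \<in> P \<and> (insert y A, B) \<in> P \<and>
      (A, insert x B) \<in> P \<and> (A, insert y B) \<in> P \<and> card A < k - 1 \<and> card B < n - k - 1"
    using AB by blast
qed

text \<open>If \<open>j0 = 0\<close>, then \<open>J\<close> and \<open>J'\<close> are empty.
  Otherwise a least \<open>J\<close> goes with \<open>card I = k - 1\<close>, and the second
  balancing condition applies.\<close>

lemma weights_bottom:
  assumes c: "c \<in> M" and IJ: "(I, J) \<in> P" "(I, J') \<in> P" "card J = j0"
  shows "c (I, J) = c (I, J')"
proof (cases "j0 = 0")
  case True
  then have "card J = 0" "card J' = 0" "finite J" "finite J'"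
    using IJ by (auto simp: mem_cone_pairs finite_subset_V)
  then show ?thesis
    by simp
next
  case False
  then have "card I = k - 1"
    using IJ(1,3) unfolding mem_cone_pairs j0_eq by linarith
  then show ?thesis
    using minkowski_weights_left[OF c] IJ by blast
qed

text \<open>Dual to \<open>weights_bottom\<close>: either \<open>I\<close> and \<open>I'\<close> are
  empty, or \<open>card J = n - k - 1\<close> and the third balancing condition applies.\<close>

lemma weights_top:
  assumes c: "c \<in> M" and IJ: "(I, J) \<in> P" "(I', J) \<in> P" "card J = j0 + L"
  shows "c (I, J) = c (I', J)"
proof (cases "j0 + L = N")
  case True
  then have "card I = 0" "card I' = 0" "finite I" "finite I'"
    using IJ by (auto simp: mem_cone_pairs finite_subset_V)
  then show ?thesis
    by simp
next
  case False
  then have "card J = n - k - 1"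
    using IJ(3) unfolding j0_L_eq by linarith
  then show ?thesis
    using minkowski_weights_right[OF c] IJ by blast
qed

section \<open>The functions \<open>basis_weight r k n S\<close> as Minkowski weights\<close>

lemma basis_weight_in_weights:
  assumes S: "S \<in> indices"
  shows "basis_weight r k n S \<in> M"
proof -
  have finS: "finite S" "card S \<le> L"
    using S finite_subset_V by (auto simp: mem_indices)
  show ?thesis
    unfolding minkowski_weights_def mem_Collect_eq
  proof (intro conjI allI impI; (elim conjE)?)
    fix A B x y
    assume AB: "x \<notin> A" "x \<notin> B" "y \<notin> A" "y \<notin> B" "x \<noteq> y" "A \<inter> B = {}"
      and in_P: "(insert x A, B) \<in> P" "(insert y A, B) \<in> P"
        "(A, insert x B) \<in> P" "(A, insert y B) \<in> P"
    have fin: "finite B"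
      using in_P by (auto simp: mem_cone_pairs finite_subset_V)
    have sub: "S \<subseteq> A \<union> B" if "S \<subseteq> insert z (A \<union> B)" "z \<notin> S" for z
      using that by blast
    \<comment> \<open>If \<open>x \<in> S\<close>, both terms with \<open>y\<close> vanish, and
      moving \<open>x\<close> from \<open>I\<close> to \<open>J\<close> raises \<open>card J\<close>
      and \<open>card (J \<inter> S)\<close> together; likewise for \<open>y\<close>. If
      \<open>S\<close> avoids both points, each difference is zero.\<close>
    have both: "\<not> (S \<subseteq> insert x (A \<union> B) \<and> S \<subseteq> insert y (A \<union> B) \<and> (x \<in> S \<or> y \<in> S))"
      using AB by blast
    show "basis_weight r k n S (insert x A, B) - basis_weight r k n S (insert y A, B) =
        basis_weight r k n S (A, insert x B) - basis_weight r k n S (A, insert y B)"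
      using both sub[of x] sub[of y] AB fin
      by (simp add: basis_weight_eq in_P Int_insert_left) blast
  next
    fix I J J' assume IJ: "(I, J) \<in> P" "(I, J') \<in> P" "card I = k - 1"
    then have J: "card J = j0" "card J' = j0"
      unfolding mem_cone_pairs j0_eq by linarith+
    \<comment> \<open>On the bottom level the weight is the indicator of
      \<open>S \<subseteq> I\<close>.\<close>
    have "J \<inter> S = {}" if "card (J \<inter> S) = 0" for J
      using that finS by simp
    then have "S \<subseteq> I \<union> J \<and> card (J \<inter> S) = 0 \<longleftrightarrow> S \<subseteq> I \<and> J \<inter> S = {}"
        if "(I, J) \<in> P" for J
      using that by auto
    moreover have "J \<inter> S = {}" if "S \<subseteq> I" "(I, J) \<in> P" for J
      using that by (auto simp: mem_cone_pairs)
    ultimately show "basis_weight r k n S (I, J) = basis_weight r k n S (I, J')"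
      using IJ(1,2) J by (auto simp: basis_weight_eq)
  next
    fix I I' J assume IJ: "(I, J) \<in> P" "(I', J) \<in> P" "card J = n - k - 1"
    then have J: "card J = j0 + L"
      unfolding mem_cone_pairs j0_L_eq by linarith
    \<comment> \<open>On the top level the bound \<open>card S \<le> L\<close> forces
      \<open>S \<subseteq> J\<close> wherever the weight is non-zero, so \<open>I\<close> drops
      out.\<close>
    have "S \<subseteq> J" if "card (J \<inter> S) = L"
    proof -
      have "J \<inter> S = S"
        using that finS by (intro card_seteq) auto
      then show ?thesis
        by blast
    qed
    then show "basis_weight r k n S (I, J) = basis_weight r k n S (I', J)"
      using IJ(1,2) J by (auto simp: basis_weight_eq)
  qed (auto simp: basis_weight_def)
qed

text \<open>Triangularity: on level \<open>s\<close> a set of size below \<open>s\<close> cannot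
  meet \<open>J\<close> in \<open>s\<close> points, and one of size \<open>s\<close> does so only
  inside \<open>J\<close>.\<close>

lemma sum_basis_weight_leading:
  assumes IJ: "(I, J) \<in> P" "card J = j0 + s"
    and large: "\<And>S. S \<in> indices \<Longrightarrow> card S > s \<Longrightarrow> a S = 0"
  shows "(\<Sum>S\<in>indices. rat_scale (a S) (basis_weight r k n S)) (I, J) = subset_sum s a J"
proof -
  have s: "s \<le> L" and J: "J \<subseteq> V"
    using IJ by (auto simp: mem_cone_pairs)
  have sum_apply: "(\<Sum>x\<in>A. f x) p = (\<Sum>x\<in>A. f x p)"
    for A :: "nat set set" and f :: "nat set \<Rightarrow> nat set \<times> nat set \<Rightarrow> rat" and p
    by (induction A rule: infinite_finite_induct) auto
  have "(\<Sum>S\<in>indices. rat_scale (a S) (basis_weight r k n S)) (I, J) =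
      (\<Sum>S\<in>indices. a S * basis_weight r k n S (I, J))"
    unfolding sum_apply by (simp add: rat_scale_def)
  also have "\<dots> = (\<Sum>S\<in>indices. if S \<in> {S. S \<subseteq> J \<and> card S = s} then a S else 0)"
  proof (intro sum.cong refl)
    fix S assume S: "S \<in> indices"
    then have fin: "finite S"
      by (auto simp: mem_indices finite_subset_V)
    consider "card S > s" | "card S < s" | "card S = s"
      by linarith
    then show "a S * basis_weight r k n S (I, J) =
        (if S \<in> {S. S \<subseteq> J \<and> card S = s} then a S else 0)"
    proof cases
      case 2
      then have "card (J \<inter> S) \<noteq> s"
        using card_mono[OF fin, of "J \<inter> S"] by auto
      then show ?thesis
        using 2 IJ by (simp add: basis_weight_eq)
    next
      case 3
      have "card (J \<inter> S) = s \<longleftrightarrow> S \<subseteq> J"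
        using 3 fin card_seteq[OF fin, of "J \<inter> S"] by (auto simp: Int_absorb1)
      then show ?thesis
        using 3 IJ by (auto simp: basis_weight_eq)
    qed (use large S in auto)
  qed
  also have "\<dots> = (\<Sum>S | S \<in> indices \<and> S \<in> {S. S \<subseteq> J \<and> card S = s}. a S)"
    using finite_indices by (intro sum.inter_filter[symmetric])
  also have "\<dots> = subset_sum s a J"
    unfolding subset_sum_def using s J by (intro sum.cong) (auto simp: mem_indices)
  finally show ?thesis .
qed

section \<open>Linear independence\<close>

lemma exists_cone_pair:
  assumes "J \<subseteq> V" "card J = j0 + s" "s \<le> L"
  obtains I where "(I, J) \<in> P"
proof -
  obtain I where "I \<subseteq> V" "I \<inter> J = {}" "card I = N - (j0 + s)"
    using exists_disjoint_subset[of V J "N - (j0 + s)"] assms j0_L N_L by auto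
  then show ?thesis
    using assms j0_L by (intro that[of I]) (auto simp: mem_cone_pairs)
qed

text \<open>Restrict to the level given by the largest size of a set with non-zero coefficient;
  there the inclusion matrix is injective.\<close>

lemma basis_weight_coefficients_unique:
  assumes zero: "(\<Sum>S\<in>indices. rat_scale (a S) (basis_weight r k n S)) = 0"
    and S: "S \<in> indices"
  shows "a S = 0"
proof (rule ccontr)
  assume "a S \<noteq> 0"
  let ?A = "{T \<in> indices. a T \<noteq> 0}"
  have fin: "finite ?A" and "?A \<noteq> {}"
    using S finite_indices \<open>a S \<noteq> 0\<close> by auto
  then obtain T where T: "T \<in> ?A" "Max (card ` ?A) = card T"
    by (rule obtains_MAX)
  have max: "card U \<le> card T" if "U \<in> indices" "a U \<noteq> 0" for U
    unfolding T(2)[symmetric] using that fin by (intro Max_ge) auto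
  define s where "s = card T"
  have s: "s \<le> L"
    using T by (simp add: s_def mem_indices)
  have "a T = 0"
  proof (rule subset_sum_eq_0_imp[of V s "j0 + s"])
    show "j0 + s + s \<le> card V" "T \<subseteq> V"
      using s j0_L N_L T by (auto simp: mem_indices)
  next
    fix J assume J: "J \<subseteq> V" "card J = j0 + s"
    then obtain I where IJ: "(I, J) \<in> P"
      using exists_cone_pair s by blast
    have "subset_sum s a J = (\<Sum>S\<in>indices. rat_scale (a S) (basis_weight r k n S)) (I, J)"
    proof (rule sum_basis_weight_leading[symmetric, OF IJ J(2)])
      show "a S = 0" if "S \<in> indices" "card S > s" for S
        using max[OF that(1)] that(2) by (auto simp: s_def)
    qed
    then show "subset_sum s a J = 0"
      using zero by simp
  qed (auto simp: s_def)
  then show False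
    using T by simp
qed

section \<open>Spanning\<close>

text \<open>A swap difference in \<open>I\<close> on level \<open>l\<close> equals one in
  \<open>J\<close> on level \<open>l + 1\<close>, where \<open>c\<close> is zero. For
  \<open>l = L\<close> the condition \<open>weights_top\<close> replaces this argument.\<close>

lemma leading_level_eq:
  assumes c: "c \<in> M" and l: "l \<le> L"
    and above: "\<And>I J. (I, J) \<in> P \<Longrightarrow> j0 + l < card J \<Longrightarrow> c (I, J) = 0"
    and IJ: "(I, J) \<in> P" "(I', J) \<in> P" "card J = j0 + l"
  shows "c (I, J) = c (I', J)"
proof (cases "l = L")
  case False
  define W where "W = V - J"
  have finW: "finite W"
    by (simp add: W_def)
  have I: "I \<subseteq> W" "card I' = card I" "I' \<subseteq> W" "J \<subseteq> V" "card I + card J = N"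
    using IJ by (auto simp: mem_cone_pairs W_def)
  have "swap_vanishing 1 W (card I) (\<lambda>I. c (I, J))"
  proof (cases "card I")
    case (Suc q)
    have "c (insert x A, J) - c (insert y A, J) = 0"
      if xy: "x \<in> W" "y \<in> W" "x \<noteq> y" and A: "A \<subseteq> W - {x, y}" "card A = q" for x y A
    proof -
      have "c (insert x A, J) - c (insert y A, J) = c (A, insert x J) - c (A, insert y J)"
        using xy A I IJ False l Suc by (intro weights_exchange[OF c]) (auto simp: W_def)
      moreover have "c (A, insert z J) = 0" if "z \<in> {x, y}" for z
      proof (rule above)
        show "(A, insert z J) \<in> P" "j0 + l < card (insert z J)"
          using xy A I IJ(3) False l Suc that finite_subset_V[OF I(4)]
          by (auto simp: W_def mem_cone_pairs)
      qed
      ultimately show ?thesis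
        by simp
    qed
    then show ?thesis
      using Suc by simp
  qed simp
  \<comment> \<open>A single vanishing swap difference makes the values constant, since
    \<open>subset_sum 0 a K\<close> is \<open>a {}\<close>.\<close>
  then obtain a where "\<And>K. K \<subseteq> W \<Longrightarrow> card K = card I \<Longrightarrow> c (K, J) = subset_sum 0 a K"
    using swap_vanishing_imp_subset_sum[of W 0 "card I" "\<lambda>I. c (I, J)"] finW
      card_mono[OF finW I(1)] by auto
  then show ?thesis
    using I finW by (simp add: subset_sum_0 finite_subset)
qed (use weights_top[OF c] IJ in blast)

lemma leading_level_subset_sum:
  assumes c: "c \<in> M" and l: "l \<le> L"
    and above: "\<And>I J. (I, J) \<in> P \<Longrightarrow> j0 + l < card J \<Longrightarrow> c (I, J) = 0"
  obtains a where
    "\<And>I J. (I, J) \<in> P \<Longrightarrow> card J = j0 + l \<Longrightarrow> c (I, J) = subset_sum l a J"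
proof -
  \<comment> \<open>On level \<open>l\<close> the choice of \<open>I\<close> is harmless by
    \<open>leading_level_eq\<close>.\<close>
  define h where "h J = c (SOME I. (I, J) \<in> P, J)" for J
  have h: "c (I, J) = h J" if "(I, J) \<in> P" "card J = j0 + l" for I J
    unfolding h_def using that
    by (intro leading_level_eq[OF c l above]) (auto intro: someI)
  have "swap_vanishing (Suc l) V (j0 + l) h"
  proof (rule swap_vanishing_local)
    \<comment> \<open>The size of \<open>U\<close> is chosen so that its complement \<open>A\<close>
      forms a pair with every \<open>J \<subseteq> U\<close> of size \<open>j0 + l\<close>.\<close>
    fix U assume U: "U \<subseteq> V" "card U = n - (N - (j0 + l))"
    define A where "A = V - U"
    have A: "A \<subseteq> V" "V - A = U" "card A + (j0 + l) = N"
      using U j0_L N_L l by (auto simp: A_def card_Diff_subset finite_subset_V)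
    have "swap_vanishing (Suc l) (V - A) (j0 + l) (\<lambda>J. c (A, J))"
    proof (rule swap_vanishing_of_exchange)
      fix A B x y
      assume "A \<subseteq> V" "B \<subseteq> V" "A \<inter> B = {}" "x \<in> V - A - B" "y \<in> V - A - B" "x \<noteq> y"
        "Suc (card A + card B) = N" "j0 \<le> card B" "card B < j0 + l"
      then show "c (insert x A, B) - c (insert y A, B) = c (A, insert x B) - c (A, insert y B)"
        using l by (intro weights_exchange[OF c]) auto
    next
      fix A B B'
      assume "A \<subseteq> V" "B \<subseteq> V - A" "B' \<subseteq> V - A" "card A + j0 = N" "card B = j0" "card B' = j0"
      then show "c (A, B) = c (A, B')"
        by (intro weights_bottom[OF c]) (auto simp: mem_cone_pairs)
    qed (use A in auto)
    moreover have "c (A, J) = h J" if "J \<subseteq> V - A" "card J = j0 + l" for J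
      using that A l by (intro h) (auto simp: mem_cone_pairs)
    ultimately show "swap_vanishing (Suc l) U (j0 + l) h"
      using A(2) swap_vanishing_cong[of "V - A" "j0 + l" "\<lambda>J. c (A, J)" h]
        finite_subset_V[OF U(1)] by simp
  qed (use j0_L N_L l in auto)
  then obtain a where "\<And>J. J \<subseteq> V \<Longrightarrow> card J = j0 + l \<Longrightarrow> h J = subset_sum l a J"
    using swap_vanishing_imp_subset_sum[of V l "j0 + l" h] j0_L N_L l by auto
  then have "c (I, J) = subset_sum l a J" if "(I, J) \<in> P" "card J = j0 + l" for I J
    using h[OF that] that by (auto simp: mem_cone_pairs)
  then show ?thesis
    using that by blast
qed

text \<open>Here \<open>l\<close> counts the bottom levels on which \<open>c\<close> may be
  non-zero; each step clears the highest of them.\<close>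

lemma weight_in_span:
  assumes "c \<in> M" "l \<le> Suc L"
    and "\<And>I J. (I, J) \<in> P \<Longrightarrow> j0 + l \<le> card J \<Longrightarrow> c (I, J) = 0"
  shows "c \<in> ratfun.span (basis_weight r k n ` indices)"
  using assms
proof (induction l arbitrary: c)
  case 0
  have "c (I, J) = 0" for I J
    using 0 minkowski_weights_outside[OF 0(1)] by (cases "(I, J) \<in> P") (auto simp: mem_cone_pairs)
  then have "c = 0"
    by (auto simp: fun_eq_iff)
  then show ?case
    by (simp only: ratfun.span_zero)
next
  case (Suc l)
  obtain a where a: "\<And>I J. (I, J) \<in> P \<Longrightarrow> card J = j0 + l \<Longrightarrow> c (I, J) = subset_sum l a J"
    using leading_level_subset_sum[OF Suc.prems(1), of l] Suc.prems by auto
  \<comment> \<open>Keeping only the sets of size \<open>l\<close> makes \<open>d\<close> agree with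
    \<open>c\<close> on level \<open>l\<close> and vanish on the higher levels.\<close>
  define b where "b S = (if card S = l then a S else 0)" for S
  define d where "d = (\<Sum>S\<in>indices. rat_scale (b S) (basis_weight r k n S))"
  have "d \<in> M"
    unfolding d_def
    by (intro ratfun.subspace_sum ratfun.subspace_scale subspace_minkowski_weights
        basis_weight_in_weights)
  then have cd: "c - d \<in> M"
    using Suc.prems(1) by (intro ratfun.subspace_diff subspace_minkowski_weights)
  have vanish: "(c - d) (I, J) = 0" if IJ: "(I, J) \<in> P" "j0 + l \<le> card J" for I J
  proof -
    obtain s where s: "card J = j0 + s" "l \<le> s"
      using IJ(2) by (metis add_le_cancel_left le_add1 le_iff_add le_trans)
    have d: "d (I, J) = subset_sum s b J"
      unfolding d_def using s by (intro sum_basis_weight_leading IJ) (auto simp: b_def)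
    show ?thesis
    proof (cases "s = l")
      case True
      then show ?thesis
        using a[OF IJ(1)] s d by (simp add: b_def subset_sum_def)
    next
      case False
      then show ?thesis
        using Suc.prems(3)[OF IJ(1)] s d by (simp add: b_def subset_sum_def)
    qed
  qed
  have "c - d \<in> ratfun.span (basis_weight r k n ` indices)"
    by (rule Suc.IH[OF cd _ vanish]) (use Suc.prems(2) in auto)
  moreover have "d \<in> ratfun.span (basis_weight r k n ` indices)"
    unfolding d_def
    by (intro ratfun.span_sum ratfun.span_scale ratfun.span_base imageI)
  ultimately have "c - d + d \<in> ratfun.span (basis_weight r k n ` indices)"
    by (rule ratfun.span_add)
  then show ?case
    by simp
qed

lemma span_basis_weight: "ratfun.span (basis_weight r k n ` indices) = M"
proof
  show "ratfun.span (basis_weight r k n ` indices) \<subseteq> M"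
    using basis_weight_in_weights subspace_minkowski_weights by (intro ratfun.span_minimal) auto
  \<comment> \<open>For \<open>Suc L\<close> the vanishing hypothesis is vacuous: no pair lies above
    level \<open>L\<close>.\<close>
  show "M \<subseteq> ratfun.span (basis_weight r k n ` indices)"
    using weight_in_span[of _ "Suc L"] by (auto simp: mem_cone_pairs)
qed

section \<open>Basis and dimension\<close>

lemma inj_on_basis_weight: "inj_on (basis_weight r k n) indices"
proof (rule inj_onI, rule ccontr)
  fix S T
  assume ST: "S \<in> indices" "T \<in> indices" "basis_weight r k n S = basis_weight r k n T" "S \<noteq> T"
  let ?a = "\<lambda>U. if U = S then 1 else if U = T then - 1 else 0 :: rat"
  have "(\<Sum>U\<in>indices. rat_scale (?a U) (basis_weight r k n U)) =
      (\<Sum>U\<in>{S, T}. rat_scale (?a U) (basis_weight r k n U))"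
    using ST finite_indices by (intro sum.mono_neutral_right) (auto simp: rat_scale_def fun_eq_iff)
  also have "\<dots> = 0"
    using ST by (simp add: rat_scale_def fun_eq_iff)
  finally show False
    using basis_weight_coefficients_unique[of ?a S] ST(1) by simp
qed

lemma independent_basis_weight: "ratfun.independent (basis_weight r k n ` indices)"
proof
  assume "ratfun.dependent (basis_weight r k n ` indices)"
  then obtain u where u: "\<exists>S\<in>indices. u (basis_weight r k n S) \<noteq> 0"
    "(\<Sum>f\<in>basis_weight r k n ` indices. rat_scale (u f) f) = 0"
    using finite_indices by (auto simp: ratfun.dependent_finite)
  then show False
    using basis_weight_coefficients_unique[of "\<lambda>S. u (basis_weight r k n S)"]
    by (auto simp: sum.reindex[OF inj_on_basis_weight])
qed

lemma is_family_basis_basis_weight: "is_family_basis (basis_weight r k n) (subsets_upto n L) M"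
  using inj_on_basis_weight independent_basis_weight span_basis_weight
  by (simp add: is_family_basis_def indices_def)

lemma chow_betti_eq: "chow_betti r k n = (\<Sum>i = 0..L. n choose i)"
proof -
  have "chow_betti r k n = card indices"
    using ratfun.dim_eq_card[of "basis_weight r k n ` indices" M] span_basis_weight
      independent_basis_weight inj_on_basis_weight ratfun.span_span
    unfolding chow_betti_def by (metis card_image)
  also have "indices = (\<Union>i\<in>{0..L}. {S. S \<subseteq> V \<and> card S = i})"
    by (auto simp: mem_indices)
  also have "card \<dots> = (\<Sum>i = 0..L. card {S. S \<subseteq> V \<and> card S = i})"
    by (intro card_UN_disjoint) auto
  also have "\<dots> = (\<Sum>i = 0..L. n choose i)"
    by (simp add: n_subsets)
  finally show ?thesis .
qed

end

theorem theorem3p1: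
  fixes n k r :: nat
  assumes "n \<ge> 2" and "1 \<le> k" and "k \<le> n div 2" and "1 \<le> r" and "r \<le> n - 1"
  shows "(r \<le> k \<longrightarrow>
            chow_betti r k n = (\<Sum>i = 0..r - 1. n choose i) \<and>
            is_family_basis (basis_weight r k n) (subsets_upto n (r - 1)) (minkowski_weights r k n)) \<and>
         (k < r \<and> r < n - k \<longrightarrow>
            chow_betti r k n = (\<Sum>i = 0..k - 1. n choose i) \<and>
            is_family_basis (basis_weight r k n) (subsets_upto n (k - 1)) (minkowski_weights r k n)) \<and>
         (n - k \<le> r \<longrightarrow>
            chow_betti r k n = (\<Sum>i = 0..n - r - 1. n choose i) \<and>
            is_family_basis (basis_weight r k n) (subsets_upto n (n - r - 1)) (minkowski_weights r k n))"
proof -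
  interpret hypersimplex n k r
    using assms by unfold_locales
  have "chow_betti r k n = (\<Sum>i = 0..d. n choose i) \<and>
      is_family_basis (basis_weight r k n) (subsets_upto n d) M" if "L = d" for d
    using chow_betti_eq is_family_basis_basis_weight that by simp
  \<comment> \<open>The bound \<open>k \<le> n - k\<close> resolves the minimum in \<open>m\<close>.
    The first and third ranges meet only for \<open>r = k = n - k\<close>, where
    \<open>r - 1\<close> and \<open>n - r - 1\<close> coincide.\<close>
  moreover have "L = r - 1" if "r \<le> k"
    using that two_k r unfolding L_def m_def N_def by linarith
  moreover have "L = k - 1" if "k < r \<and> r < n - k"
    using that unfolding L_def m_def N_def by linarith
  moreover have "L = n - r - 1" if "n - k \<le> r"
    using that two_k r unfolding L_def m_def N_def by linarith
  ultimately show ?thesis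
    by blast
qed

end
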